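(* For every positive integer $N$ and every integer $d>2$, there exists an isometric $(n_d)$ point-circle configuration in the plane with $n>N$.
   Context: An $(n_d)$ configuration is an incidence structure with $n$ points and $n$ blocks, each block incident with exactly $d$ points and each point with exactly $d$ blocks. An isometric $(n_d)$ point-circle configuration is such an incidence structure realized in the Euclidean plane by $n$ distinct points and $n$ distinct circles, all of the same radius, such that each point lies on the circle of every block incident with it. *)

theory Defs
  imports "HOL-Analysis.Analysis"
begin

text \<open>An incidence structure is given by a set \<open>P\<close> of points, a set \<open>B\<close> of blocks and an
  incidence relation \<open>I\<close> between them. Two points may be incident with several common blocks:
  linearity is not part of the notion of configuration used here.\<close>

definition incidence_structure :: "'p set \<Rightarrow> 'b set \<Rightarrow> ('p \<times> 'b) set \<Rightarrow> bool" where
  "incidence_structure P B I \<longleftrightarrow> I \<subseteq> P \<times> B"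

definition configuration :: "nat \<Rightarrow> nat \<Rightarrow> 'p set \<Rightarrow> 'b set \<Rightarrow> ('p \<times> 'b) set \<Rightarrow> bool" where
  "configuration n d P B I \<longleftrightarrow>
     incidence_structure P B I \<and>
     finite P \<and> card P = n \<and> finite B \<and> card B = n \<and>
     (\<forall>b\<in>B. card {p\<in>P. (p, b) \<in> I} = d) \<and>
     (\<forall>p\<in>P. card {b\<in>B. (p, b) \<in> I} = d)"

text \<open>A realization places the points at distinct points of the plane and the blocks at distinct
  circles (as point sets) of one common positive radius. Incident pairs have to be incident in the
  plane; a point may also lie on circles of blocks it is not incident with.\<close>

definition isometric_point_circle_realization ::
    "'p set \<Rightarrow> 'b set \<Rightarrow> ('p \<times> 'b) set \<Rightarrow> ('p \<Rightarrow> real ^ 2) \<Rightarrow> ('b \<Rightarrow> (real ^ 2) set) \<Rightarrow> bool" where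
  "isometric_point_circle_realization P B I pt circ \<longleftrightarrow>
     inj_on pt P \<and> inj_on circ B \<and>
     (\<exists>r>0. \<forall>b\<in>B. \<exists>z. circ b = sphere z r) \<and>
     (\<forall>(p, b)\<in>I. pt p \<in> circ b)"

definition isometric_point_circle_configuration ::
    "nat \<Rightarrow> nat \<Rightarrow> 'p set \<Rightarrow> 'b set \<Rightarrow> ('p \<times> 'b) set \<Rightarrow>
     ('p \<Rightarrow> real ^ 2) \<Rightarrow> ('b \<Rightarrow> (real ^ 2) set) \<Rightarrow> bool" where
  "isometric_point_circle_configuration n d P B I pt circ \<longleftrightarrow>
     configuration n d P B I \<and> isometric_point_circle_realization P B I pt circ"

end

theory Submission imports Defs
begin

text \<open>The incidence graph is a disjoint union of copies of the \<open>d\<close>-dimensional hypercube,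
  split into its vertices of even and odd weight. The hypercube is projected to the plane so that
  its edges in direction \<open>i\<close> become translates of \<open>(2 ^ i, sqrt (4 ^ d - 4 ^ i))\<close>, a vector of
  length \<open>2 ^ d\<close>. Then the vertex with binary code \<open>k\<close> has first coordinate \<open>k\<close>, so all vertices
  are distinct, and the bits of \<open>k\<close> from position \<open>d\<close> on can be used to number the copies.\<close>

definition low_bits :: "nat \<Rightarrow> nat \<Rightarrow> nat set" where
  "low_bits d k = {i. i < d \<and> bit k i}"

text \<open>The first coordinate keeps the bits from \<open>d\<close> on, so different copies of the
  hypercube are horizontal translates by multiples of \<open>2 ^ d\<close>.\<close>

definition place :: "nat \<Rightarrow> nat \<Rightarrow> real ^ 2" where
  "place d k = vector [real k, \<Sum>i\<in>low_bits d k. sqrt (4 ^ d - 4 ^ i)]"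

lemma finite_low_bits [simp]: "finite (low_bits d k)"
  by (simp add: low_bits_def)

lemma flip_bit_twice [simp]: "flip_bit i (flip_bit i k) = (k :: nat)"
  by (rule bit_eqI) (auto simp: bit_flip_bit_iff)

lemma bit_flip_bit_nat: "bit (flip_bit i k) j \<longleftrightarrow> (if i = j then \<not> bit k j else bit k j)"
  for k :: nat
  by (auto simp: bit_flip_bit_iff)

lemma inj_flip_bit: "inj (\<lambda>i. flip_bit i (k :: nat))"
  by (rule injI) (metis bit_flip_bit_nat)

text \<open>Flipping a bit below \<open>d\<close> preserves \<open>k div 2 ^ d\<close>, the number
  of the copy, and the bound depends on that quotient alone.\<close>

lemma flip_bit_less_mult:
  fixes k :: nat
  assumes "i < d" "k < 2 ^ d * m"
  shows "flip_bit i k < 2 ^ d * m"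
proof -
  have "drop_bit d (flip_bit i k) = drop_bit d k"
    using assms(1) by (intro bit_eqI) (auto simp: bit_drop_bit_eq bit_flip_bit_nat)
  then show ?thesis
    using assms(2) by (simp add: drop_bit_eq_div mult.commute flip: div_less_iff_less_mult)
qed

lemma low_bits_flip_bit:
  assumes "i < d" "\<not> bit k i"
  shows "low_bits d (flip_bit i k) = insert i (low_bits d k)" "i \<notin> low_bits d k"
  using assms by (auto simp: low_bits_def bit_flip_bit_nat split: if_splits)

text \<open>A flip adds or removes exactly one element of \<open>low_bits d k\<close>. Hence every
  hypercube edge joins a point to a block.\<close>

lemma even_card_low_bits_flip_bit:
  assumes "i < d"
  shows "even (card (low_bits d (flip_bit i k))) \<longleftrightarrow> odd (card (low_bits d k))"
proof -
  have *: "even (card (low_bits d (flip_bit i k))) \<longleftrightarrow> odd (card (low_bits d k))"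
    if "\<not> bit k i" for k
    using low_bits_flip_bit[OF assms that] by simp
  show ?thesis
    using *[of k] *[of "flip_bit i k"] by (cases "bit k i") (auto simp: bit_flip_bit_nat)
qed

text \<open>Up to sign the difference is \<open>(2 ^ i, sqrt (4 ^ d - 4 ^ i))\<close>, where the
  squares add up to \<open>4 ^ d\<close>; this is independent of \<open>i\<close>, so one radius
  serves all edges.\<close>

lemma dist_place_flip_bit:
  assumes "i < d"
  shows "dist (place d (flip_bit i k)) (place d k) = 2 ^ d"
proof -
  have *: "dist (place d (flip_bit i k)) (place d k) = 2 ^ d" if "\<not> bit k i" for k
  proof -
    have x: "real (flip_bit i k) = real k + 2 ^ i"
      using that by (simp add: flip_bit_eq_if set_bit_eq)
    have "(4 :: real) ^ i \<le> 4 ^ d"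
      using assms by (intro power_increasing) auto
    moreover have "(2 ^ i)\<^sup>2 = (4 :: real) ^ i" "(4 :: real) ^ d = (2 ^ d)\<^sup>2"
      by (simp_all add: power2_eq_square flip: power_mult_distrib)
    ultimately show ?thesis
      by (simp add: dist_vec_def L2_set_def sum_2 place_def x dist_real_def
          low_bits_flip_bit[OF assms that])
  qed
  show ?thesis
    using *[of k] *[of "flip_bit i k"]
    by (cases "bit k i") (auto simp: bit_flip_bit_nat dist_commute)
qed

lemma inj_place: "inj (place d)"
  by (rule injI) (metis of_nat_eq_iff place_def vector_2(1))

lemma sphere_center_inject:
  fixes a b :: "'a :: real_normed_vector"
  assumes "sphere a r = sphere b r" "r > 0"
  shows "a = b"
proof (rule ccontr)
  assume "a \<noteq> b"
  \<comment> \<open>\<open>c\<close> is the point of the first sphere farthest from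
    \<open>b\<close>, on the ray from \<open>b\<close> through \<open>a\<close>; its distance to
    \<open>b\<close> exceeds \<open>r\<close> by \<open>norm (a - b)\<close>.\<close>
  define c where "c = a + (r / norm (a - b)) *\<^sub>R (a - b)"
  have "c \<in> sphere a r"
    using \<open>a \<noteq> b\<close> \<open>r > 0\<close> by (simp add: c_def dist_norm)
  then have "dist b c = r"
    using assms(1) by auto
  moreover have "c - b = (1 + r / norm (a - b)) *\<^sub>R (a - b)"
    by (simp add: c_def algebra_simps)
  then have "norm (c - b) = \<bar>1 + r / norm (a - b)\<bar> * norm (a - b)"
    by simp
  then have "norm (c - b) = norm (a - b) + r"
    using \<open>a \<noteq> b\<close> \<open>r > 0\<close> by (simp add: abs_of_pos add_pos_pos distrib_right)
  ultimately show False
    using \<open>a \<noteq> b\<close> by (simp add: dist_norm norm_minus_commute)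
qed

theorem theorem5p3:
  fixes N d :: nat
  assumes "N > 0" and "d > 2"
  shows "\<exists>n>N. \<exists>(P :: nat set) (B :: nat set) I pt circ.
           isometric_point_circle_configuration n d P B I pt circ"
proof -
  define V where "V = {..<2 ^ d * (N + 1)}"
  define P where "P = {k\<in>V. even (card (low_bits d k))}"
  define B where "B = {k\<in>V. odd (card (low_bits d k))}"
  define I where "I = {(p, b). p \<in> P \<and> b \<in> B \<and> (\<exists>i<d. b = flip_bit i p)}"
  \<comment> \<open>Each odd vertex becomes the centre of a circle, which passes through its
    \<open>d\<close> even neighbours.\<close>
  define circ where "circ k = sphere (place d k) (2 ^ d)" for k
  have "I \<subseteq> P \<times> B"
    by (auto simp: I_def)
  have fin: "finite P" "finite B"
    by (simp_all add: P_def B_def V_def)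
  have flipV: "flip_bit i k \<in> V" if "k \<in> V" "i < d" for i k
    using that flip_bit_less_mult[of i d k "N + 1"] unfolding V_def by blast
  have flipP: "flip_bit i p \<in> B" if "p \<in> P" "i < d" for i p
    using that flipV even_card_low_bits_flip_bit by (auto simp: P_def B_def)
  have flipB: "flip_bit i b \<in> P" if "b \<in> B" "i < d" for i b
    using that flipV even_card_low_bits_flip_bit by (auto simp: P_def B_def)
  \<comment> \<open>The edges in direction 0 form a perfect matching between points and
    blocks.\<close>
  have "bij_betw (flip_bit 0) P B"
    using flipP flipB \<open>d > 2\<close> by (intro bij_betw_byWitness[where f' = "flip_bit 0"]) auto
  then have card_B: "card B = card P"
    by (simp add: bij_betw_same_card)
  have blocks: "{b\<in>B. (p, b) \<in> I} = (\<lambda>i. flip_bit i p) ` {..<d}" if "p \<in> P" for p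
    using that flipP by (auto simp: I_def)
  have points: "{p\<in>P. (p, b) \<in> I} = (\<lambda>i. flip_bit i b) ` {..<d}" if "b \<in> B" for b
    using that flipB by (force simp: I_def)
  have "card ((\<lambda>i. flip_bit i k) ` {..<d}) = d" for k :: nat
    using card_image[OF inj_on_subset[OF inj_flip_bit subset_UNIV], of k "{..<d}"] by simp
  then have "configuration (card P) d P B I"
    using fin card_B \<open>I \<subseteq> P \<times> B\<close>
    by (simp add: configuration_def incidence_structure_def blocks points)
  moreover have "isometric_point_circle_realization P B I (place d) circ"
    unfolding isometric_point_circle_realization_def
  proof (intro conjI)
    show "inj_on (place d) P"
      using inj_place inj_on_subset by blast
    show "inj_on circ B"
      unfolding circ_def
      by (intro inj_onI) (metis sphere_center_inject zero_less_power zero_less_numeral inj_place injD)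
    show "\<exists>r>0. \<forall>b\<in>B. \<exists>z. circ b = sphere z r"
      unfolding circ_def by (intro exI[of _ "2 ^ d"]) auto
    show "\<forall>(p, b)\<in>I. place d p \<in> circ b"
      by (auto simp: I_def circ_def dist_place_flip_bit)
  qed
  moreover have "N < card P"
  proof -
    \<comment> \<open>The all-zero vertex of each of the \<open>N + 1\<close> copies has weight 0,
      hence is a point; counting these alone already exceeds \<open>N\<close>.\<close>
    have "low_bits d (2 ^ d * t) = {}" for t
      by (auto simp: low_bits_def bit_push_bit_iff mult.commute[of _ t] simp flip: push_bit_eq_mult)
    moreover have "2 ^ d * t \<in> V" if "t \<le> N" for t
      using that unfolding V_def lessThan_iff by (intro mult_strict_left_mono) auto
    ultimately have "(\<lambda>t. 2 ^ d * t) ` {..N} \<subseteq> P"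
      by (auto simp: P_def)
    then have "card ((\<lambda>t. 2 ^ d * t :: nat) ` {..N}) \<le> card P"
      by (intro card_mono fin)
    then show ?thesis
      by (subst (asm) card_image) (auto simp: inj_on_def)
  qed
  ultimately show ?thesis
    unfolding isometric_point_circle_configuration_def by blast
qed

end
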